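(* Let $n\geq 20$ be an integer, let $x=2^{6^{2^{6^n}}}$, and let $m>e^{e^{3x}}$. Then every proper sequence $v=(v_1,\ldots,v_m)$ of points in $\mathbb{R}^2$ has a subsequence $(v_{i_1},\ldots,v_{i_n})$, $i_1<\cdots<i_n$, of length $n$ which is admissible.
   Context: For $u_1,u_2,u_3\in\mathbb{R}^2$, $\Delta(u_1,u_2,u_3)=\det(u_1-u_2,\,u_3-u_2)$ (oriented area of the parallelogram spanned by $\overrightarrow{u_2u_1}$, $\overrightarrow{u_2u_3}$). A sequence $(w_1,\ldots,w_k)$ of points in $\mathbb{R}^2$ (with $w_{k+1}=w_1$) is proper if $\Delta(w_1,w_2,w_3)>0$ and for every $j$ the segment $\operatorname{conv}\{w_j,w_{j+1}\}$ is an edge of $\operatorname{conv}\{w_1,\ldots,w_k\}$. Its slack matrix $S$ is the $k\times k$ matrix with $S_i^j=\Delta(w_i,w_j,w_{j+1})$ (row $i$, column $j$). A proper sequence is admissible if for all indices $p,q,r,t\in\{1,\ldots,k\}$ satisfying either (i) $\min\{p,q-1\}>r>t$ or (ii) $q>p>\max\{r,t\}$, it holds that $S_t^pS_q^r>S_q^pS_t^r$.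
   Formalization: Proper sequences are also required to have pairwise distinct points, and admissibility is required only for p<k; literally, repeated walks round a triangle are counterexamples, and (p,q,r,t)=(k,4,2,1) demands 0 > a non-negative number. *)

theory Defs
  imports "HOL-Analysis.Analysis"
begin

text \<open>A sequence \<open>(w\<^sub>1, \<dots>, w\<^sub>k)\<close> is a function \<open>w :: nat \<Rightarrow> real^2\<close> together with its length \<open>k\<close>;
  only the values on \<open>{1..k}\<close> matter.\<close>

definition Delta :: "real^2 \<Rightarrow> real^2 \<Rightarrow> real^2 \<Rightarrow> real" where
  "Delta u1 u2 u3 = det (transpose (vector [u1 - u2, u3 - u2] :: real^2^2))"

definition cyc_suc :: "nat \<Rightarrow> nat \<Rightarrow> nat" where
  "cyc_suc k j = (if j = k then 1 else j + 1)"

text \<open>The terms of a proper sequence are the vertices of a \<open>k\<close>-gon, each listed once. Injectivity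
  does not follow from the edge condition alone, which also holds for sequences that run around
  the same polygon several times or backtrack along it.\<close>

definition proper :: "nat \<Rightarrow> (nat \<Rightarrow> real^2) \<Rightarrow> bool" where
  "proper k w \<longleftrightarrow>
     3 \<le> k \<and>
     inj_on w {1..k} \<and>
     Delta (w 1) (w 2) (w 3) > 0 \<and>
     (\<forall>j\<in>{1..k}. (convex hull {w j, w (cyc_suc k j)}) edge_of (convex hull (w ` {1..k})))"

definition slack :: "nat \<Rightarrow> (nat \<Rightarrow> real^2) \<Rightarrow> nat \<Rightarrow> nat \<Rightarrow> real" where
  "slack k w i j = Delta (w i) (w j) (w (cyc_suc k j))"

text \<open>The condition \<open>p < k\<close> excludes the closing edge \<open>w\<^sub>k w\<^sub>1\<close> as column \<open>p\<close> (in the second case it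
  is implied by \<open>p < q\<close>). It cannot be dropped: for \<open>k \<ge> 5\<close> and \<open>(p, q, r, t) = (k, 4, 2, 1)\<close> the
  left-hand side contains the factor \<open>slack k w 1 k = 0\<close> while the right-hand side is
  non-negative.\<close>

definition admissible :: "nat \<Rightarrow> (nat \<Rightarrow> real^2) \<Rightarrow> bool" where
  "admissible k w \<longleftrightarrow>
     proper k w \<and>
     (\<forall>p\<in>{1..k}. \<forall>q\<in>{1..k}. \<forall>r\<in>{1..k}. \<forall>t\<in>{1..k}.
        p < k \<and> (min p (q - 1) > r \<and> r > t \<or> q > p \<and> p > max r t) \<longrightarrow>
        slack k w t p * slack k w q r > slack k w q p * slack k w t r)"

end

theory Submission
  imports Defs
begin

text \<open>Write \<open>[abc]\<close> for \<open>Delta w\<^sub>a w\<^sub>b w\<^sub>c\<close>, which is positive for \<open>a < b < c\<close> along a proper sequence. By the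
  three-term Pluecker relation every instance of admissibility holds automatically, except those in
  which the six points involved, numbered in increasing order, require \<open>\<alpha> < \<beta>\<close> or \<open>\<alpha> < \<gamma>\<close>, where
  \<open>\<alpha> = [123][456]\<close>, \<open>\<beta> = [234][156]\<close> and \<open>\<gamma> = [345][126]\<close>. Colour each sextuple by the truth values
  of these two inequalities and pass to a homogeneous subsequence, using the Erdos-Rado bound for
  Ramsey numbers. On eight points \<open>\<alpha> \<ge> \<beta>\<close> cannot hold throughout: comparing
  sextuples shifted by one point, \<open>\<alpha> \<ge> \<beta>\<close> yields \<open>\<beta> > \<gamma>\<close>, which yields \<open>\<gamma> > \<alpha>\<close>. The mirror image of
  this argument excludes \<open>\<alpha> \<ge> \<gamma>\<close>.\<close>

section \<open>Ramsey numbers of uniform hypergraphs\<close>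

text \<open>The partition relation N -> (n)^k_q of Ramsey theory, over sets of naturals. Colourings
  are total and bounded on every set, so that colourings derived from them need no side
  conditions.\<close>

definition arrows :: "nat \<Rightarrow> nat \<Rightarrow> nat \<Rightarrow> nat \<Rightarrow> bool" where
  "arrows q k n N \<longleftrightarrow>
     (\<forall>(f :: nat set \<Rightarrow> nat) A. finite A \<and> N \<le> card A \<and> (\<forall>U. f U < q) \<longrightarrow>
        (\<exists>H\<subseteq>A. card H = n \<and> (\<exists>c. \<forall>U\<subseteq>H. card U = k \<longrightarrow> f U = c)))"

lemma arrowsE:
  fixes f :: "nat set \<Rightarrow> nat"
  assumes "arrows q k n N" "finite A" "N \<le> card A" "\<forall>U. f U < q"
  obtains H c where "H \<subseteq> A" "card H = n" "\<And>U. U \<subseteq> H \<Longrightarrow> card U = k \<Longrightarrow> f U = c"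
  using assms unfolding arrows_def by metis

text \<open>Pigeonhole principle, multiplied out to avoid division: otherwise adding up the fibres
  over \<open>B\<close> falls short of \<open>card S\<close>.\<close>

lemma large_fibre:
  assumes "finite S" "finite B" "h ` S \<subseteq> B"
  shows "\<exists>y. card S \<le> card {s \<in> S. h s = y} * card B"
proof (rule ccontr)
  assume "\<not> ?thesis"
  then have less: "card {s \<in> S. h s = y} * card B < card S" for y
    by (simp add: not_le)
  have "S \<noteq> {}" using less[of undefined] by auto
  with assms have Bne: "B \<noteq> {}" by blast
  have "card S = (\<Sum>y\<in>B. card {s \<in> S. h s = y})"
  proof -
    have "S = (\<Union>y\<in>B. {s \<in> S. h s = y})" using assms by auto
    moreover have "card (\<Union>y\<in>B. {s \<in> S. h s = y}) = (\<Sum>y\<in>B. card {s \<in> S. h s = y})"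
      using assms by (intro card_UN_disjoint) auto
    ultimately show ?thesis by simp
  qed
  then have "card S * card B = (\<Sum>y\<in>B. card {s \<in> S. h s = y} * card B)"
    by (simp add: sum_distrib_right)
  also have "\<dots> < (\<Sum>y\<in>B. card S)"
    using less Bne assms by (intro sum_strict_mono) auto
  finally show False by (simp add: mult.commute)
qed

lemma arrows_1: "arrows q 1 n (q * n)"
  unfolding arrows_def
proof (intro allI impI, elim conjE)
  fix f :: "nat set \<Rightarrow> nat" and A :: "nat set"
  assume A: "finite A" "q * n \<le> card A" and f: "\<forall>U. f U < q"
  have q: "q > 0" using f by (metis gr_zeroI not_less_zero)
  obtain y where y: "card A \<le> card {s \<in> A. f {s} = y} * card {..<q}"
    using large_fibre[of A "{..<q}" "\<lambda>s. f {s}"] A(1) f by blast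
  from order_trans[OF A(2) this] have "q * n \<le> q * card {s \<in> A. f {s} = y}"
    by (simp only: card_lessThan mult.commute)
  with q have "n \<le> card {s \<in> A. f {s} = y}" by simp
  then obtain H where H: "H \<subseteq> {s \<in> A. f {s} = y}" "card H = n"
    by (meson obtain_subset_with_card_n)
  then have "\<forall>U\<subseteq>H. card U = 1 \<longrightarrow> f U = y"
    by (auto simp: card_1_singleton_iff)
  with H show "\<exists>H\<subseteq>A. card H = n \<and> (\<exists>c. \<forall>U\<subseteq>H. card U = 1 \<longrightarrow> f U = c)"
    by blast
qed

text \<open>The colour of a \<open>(k+1)\<close>-subset of \<open>A\<close> depends only on its \<open>k\<close> smallest elements; \<open>S\<close> is the
  reservoir from which \<open>A\<close> is extended greedily, each time shrinking by a bounded factor.\<close>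
lemma end_homogeneous_subset:
  fixes f :: "nat set \<Rightarrow> nat"
  assumes f: "\<forall>U. f U < q" and fin: "finite S0"
    and big: "(2 * q ^ (L ^ k)) ^ L \<le> card S0" and "0 < k" and "j \<le> L"
  shows "\<exists>A S. A \<subseteq> S0 \<and> S \<subseteq> S0 \<and> card A = j \<and> (\<forall>a\<in>A. \<forall>s\<in>S. a < s) \<and>
    card S0 \<le> card S * (2 * q ^ (L ^ k)) ^ j \<and>
    (\<forall>T\<subseteq>A. card T = k \<longrightarrow> (\<forall>s\<in>A \<union> S. \<forall>s'\<in>A \<union> S.
       (\<forall>t\<in>T. t < s \<and> t < s') \<longrightarrow> f (insert s T) = f (insert s' T)))"
    (is "\<exists>A S. ?P j A S")
  using \<open>j \<le> L\<close>
proof (induction j)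
  case 0
  \<comment> \<open>Only \<open>T = {}\<close> lies in the empty set, and it does not have size
    \<open>k > 0\<close>.\<close>
  have "?P 0 {} S0" using \<open>0 < k\<close> by auto
  then show ?case by (intro exI[of _ "{}"] exI[of _ S0])
next
  case (Suc j)
  define M where "M = 2 * q ^ (L ^ k)"
  have q: "q > 0" using f by (metis gr_zeroI not_less_zero)
  have "M > 0" using q by (simp add: M_def)
  from Suc.IH[OF Suc_leD[OF Suc.prems]] obtain A S where P: "?P j A S" by (elim exE)
  then have A: "A \<subseteq> S0" "card A = j" and S: "S \<subseteq> S0"
    and AS: "\<forall>a\<in>A. \<forall>s\<in>S. a < s" and card_S: "card S0 \<le> card S * M ^ j"
    and hom: "\<forall>T\<subseteq>A. card T = k \<longrightarrow> (\<forall>s\<in>A \<union> S. \<forall>s'\<in>A \<union> S.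
       (\<forall>t\<in>T. t < s \<and> t < s') \<longrightarrow> f (insert s T) = f (insert s' T))"
    unfolding M_def by - (elim conjE, assumption)+
  have finA: "finite A" and finS: "finite S" using A S fin finite_subset by auto
  \<comment> \<open>The reservoir has shrunk by a factor of at most \<open>M ^ j\<close>, so at
    least \<open>M\<close> elements remain for the next choice.\<close>
  have "M ^ Suc j \<le> M ^ L" using Suc.prems \<open>M > 0\<close> by (intro power_increasing) auto
  also have "\<dots> \<le> card S0" using big by (simp add: M_def)
  also note card_S
  finally have "M * M ^ j \<le> card S * M ^ j" by simp
  then have "M \<le> card S" using \<open>M > 0\<close> by simp
  moreover have "M \<ge> 2" using q by (simp add: M_def)
  ultimately have "card S \<ge> 2" by simp
  then have "S \<noteq> {}" by auto
  define a where "a = Min S"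
  have aS: "a \<in> S" and a_le: "\<And>s. s \<in> S \<Longrightarrow> a \<le> s"
    using finS \<open>S \<noteq> {}\<close> by (auto simp: a_def)
  define S' where "S' = S - {a}"
  \<comment> \<open>Removing one of at least two elements costs at most half; this is the factor 2
    in \<open>M\<close>.\<close>
  have card_S': "card S \<le> 2 * card S'"
    using \<open>card S \<ge> 2\<close> aS finS by (simp add: S'_def)
  define K where "K = {T. T \<subseteq> insert a A \<and> card T = k}"
  have "a \<notin> A" using AS aS by auto
  have finK: "finite K" using finA by (simp add: K_def)
  have "card K = Suc j choose k"
    using n_subsets[of "insert a A" k] finA A \<open>a \<notin> A\<close> by (simp add: K_def)
  also have "\<dots> \<le> Suc j ^ k"
    by (cases "k \<le> Suc j") (auto simp: binomial_le_pow binomial_eq_0)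
  also have "\<dots> \<le> L ^ k" using Suc.prems by (intro power_mono) auto
  finally have card_K: "card K \<le> L ^ k" .
  \<comment> \<open>Reservoir elements are grouped by the colouring of \<open>K\<close> that they
    induce. There are at most \<open>q ^ (L ^ k)\<close> such colourings, the other factor of
    \<open>M\<close>.\<close>
  define h where "h = (\<lambda>s. \<lambda>T\<in>K. f (insert s T))"
  have "h ` S' \<subseteq> PiE K (\<lambda>_. {..<q})" using f by (auto simp: h_def)
  then obtain y where y: "card S' \<le> card {s \<in> S'. h s = y} * card (PiE K (\<lambda>_. {..<q}))"
    using large_fibre[of S' "PiE K (\<lambda>_. {..<q})" h] finS finK
    by (auto simp: S'_def finite_PiE)
  define S2 where "S2 = {s \<in> S'. h s = y}"
  have "card S' \<le> card S2 * q ^ card K"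
    using y finK by (simp add: card_PiE S2_def)
  also have "\<dots> \<le> card S2 * q ^ (L ^ k)"
    using card_K q by (intro mult_left_mono power_increasing) auto
  finally have "card S \<le> card S2 * M" using card_S' by (simp add: M_def)
  then have "card S * M ^ j \<le> card S2 * M * M ^ j" by (rule mult_right_mono) simp
  from order_trans[OF card_S this] have c2: "card S0 \<le> card S2 * M ^ Suc j"
    by (simp only: power_Suc mult.assoc)
  have hom2: "f (insert s T) = f (insert s' T)"
    if T: "T \<subseteq> insert a A" "card T = k" and s: "s \<in> insert a A \<union> S2" "s' \<in> insert a A \<union> S2"
      and less: "\<forall>t\<in>T. t < s \<and> t < s'" for T s s'
  \<comment> \<open>If \<open>a\<close> is in \<open>T\<close>, both extensions lie beyond all of
    \<open>insert a A\<close>, hence in the fibre \<open>S2\<close>; otherwise the invariant for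
    \<open>A\<close> and \<open>S\<close> applies, as \<open>a\<close> came from
    \<open>S\<close>.\<close>
  proof (cases "a \<in> T")
    case True
    then have "a < s" "a < s'" using less by auto
    moreover have "\<forall>b\<in>insert a A. b \<le> a" using AS aS less_imp_le by blast
    ultimately have "s \<in> S2" "s' \<in> S2" using s by (meson UnE not_le)+
    then have "h s T = h s' T" by (simp add: S2_def)
    then show ?thesis using T by (simp add: h_def K_def)
  next
    case False
    then have "T \<subseteq> A" using T by auto
    moreover have "s \<in> A \<union> S" "s' \<in> A \<union> S" using s aS by (auto simp: S2_def S'_def)
    ultimately show ?thesis using T(2) less by (intro hom[rule_format]) auto
  qed
  have "?P (Suc j) (insert a A) S2"
  proof (intro conjI)
    show "insert a A \<subseteq> S0" "S2 \<subseteq> S0" using A S aS by (auto simp: S2_def S'_def)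
    show "card (insert a A) = Suc j" using A finA \<open>a \<notin> A\<close> by simp
    show "\<forall>b\<in>insert a A. \<forall>s\<in>S2. b < s"
    proof (intro ballI)
      fix b s assume "b \<in> insert a A" "s \<in> S2"
      moreover from this have "s \<in> S" "s \<noteq> a" by (auto simp: S2_def S'_def)
      ultimately show "b < s" using AS a_le[of s] by (metis insertE le_neq_implies_less)
    qed
    show "card S0 \<le> card S2 * (2 * q ^ L ^ k) ^ Suc j" using c2 by (simp add: M_def)
    show "\<forall>T\<subseteq>insert a A. card T = k \<longrightarrow> (\<forall>s\<in>insert a A \<union> S2. \<forall>s'\<in>insert a A \<union> S2.
        (\<forall>t\<in>T. t < s \<and> t < s') \<longrightarrow> f (insert s T) = f (insert s' T))"
      by (intro allI impI ballI) (rule hom2)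
  qed
  then show ?case by (intro exI[of _ "insert a A"] exI[of _ S2])
qed

text \<open>On an end-homogeneous set of size \<open>L\<close>, the colour of a
  \<open>(k+1)\<close>-set is determined by its \<open>k\<close> smallest elements. A homogeneous
  set for the induced colouring of \<open>k\<close>-sets is therefore homogeneous for
  \<open>f\<close>.\<close>

lemma arrows_Suc:
  assumes "arrows q k n L" "0 < k"
  shows "arrows q (Suc k) n ((2 * q) ^ (L ^ Suc k))"
  unfolding arrows_def
proof (intro allI impI, elim conjE)
  fix f :: "nat set \<Rightarrow> nat" and S0 :: "nat set"
  assume fin: "finite S0" and big: "(2 * q) ^ (L ^ Suc k) \<le> card S0" and f: "\<forall>U. f U < q"
  have q: "q > 0" using f by (metis gr_zeroI not_less_zero)
  have "(2 * q ^ (L ^ k)) ^ L \<le> ((2 * q) ^ (L ^ k)) ^ L"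
  \<comment> \<open>For \<open>L = 0\<close> the bases compare the wrong way, but the outer exponent
    is 0.\<close>
  proof (cases "L = 0")
    case False
    then have "(2::nat) ^ 1 \<le> 2 ^ (L ^ k)" by (intro power_increasing) auto
    then show ?thesis by (intro power_mono) (auto simp: power_mult_distrib)
  qed auto
  also have "\<dots> = (2 * q) ^ (L ^ Suc k)" by (simp only: power_mult[symmetric] power_Suc2)
  finally have "(2 * q ^ (L ^ k)) ^ L \<le> card S0" using big by simp
  from end_homogeneous_subset[OF f fin this \<open>0 < k\<close> order_refl]
  obtain A where A: "A \<subseteq> S0" "card A = L"
    and hom: "\<And>T s s'. T \<subseteq> A \<Longrightarrow> card T = k \<Longrightarrow> s \<in> A \<Longrightarrow> s' \<in> A \<Longrightarrow>
       (\<forall>t\<in>T. t < s \<and> t < s') \<Longrightarrow> f (insert s T) = f (insert s' T)"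
    by (metis UnCI)
  have finA: "finite A" using A fin finite_subset by auto
  \<comment> \<open>If no element of \<open>A\<close> lies above \<open>T\<close>, the choice is
    arbitrary and the value is still below \<open>q\<close>. Otherwise end-homogeneity makes the
    choice irrelevant.\<close>
  define g where "g T = f (insert (SOME s. s \<in> A \<and> (\<forall>t\<in>T. t < s)) T)" for T
  have "\<forall>U. g U < q" using f by (simp add: g_def)
  then obtain H c where H: "H \<subseteq> A" "card H = n" "\<And>U. U \<subseteq> H \<Longrightarrow> card U = k \<Longrightarrow> g U = c"
    using arrowsE[OF assms(1) finA] A(2) by (metis order_refl)
  have "f U = c" if U: "U \<subseteq> H" "card U = Suc k" for U
  proof -
    have finU: "finite U" "U \<noteq> {}" using U by (auto intro: card_ge_0_finite)
    define s where "s = Max U"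
    define T where "T = U - {s}"
    have sU: "s \<in> U" using finU by (simp add: s_def)
    have UT: "U = insert s T" using sU by (auto simp: T_def)
    have T: "T \<subseteq> H" "card T = k" using U sU finU by (auto simp: T_def)
    have "\<forall>t\<in>T. t < s" using finU by (auto simp: T_def s_def less_le)
    then have sA: "s \<in> A \<and> (\<forall>t\<in>T. t < s)" using sU U H by blast
    have "g T = f (insert s T)"
      unfolding g_def
      by (rule hom) (use someI[of "\<lambda>s. s \<in> A \<and> (\<forall>t\<in>T. t < s)", OF sA] sA T H in auto)
    then show ?thesis using H(3)[of T] T UT by simp
  qed
  then show "\<exists>H\<subseteq>S0. card H = n \<and> (\<exists>c. \<forall>U\<subseteq>H. card U = Suc k \<longrightarrow> f U = c)"
    using H(1,2) A(1) by (intro exI[of _ H]) auto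
qed
section \<open>Proper sequences\<close>

lemma Delta_eq: "Delta a b c =
    (a $ 1 - b $ 1) * (c $ 2 - b $ 2) - (a $ 2 - b $ 2) * (c $ 1 - b $ 1)"
  by (simp add: Delta_def det_2 transpose_def)

lemma Delta_rotate: "Delta a b c = Delta b c a"
  by (simp add: Delta_eq algebra_simps)

lemma Delta_degenerate [simp]: "Delta a a b = 0" "Delta a b a = 0" "Delta a b b = 0"
  by (simp_all add: Delta_eq)

text \<open>The three-term Grassmann-Pluecker relation for directions from \<open>o'\<close>. When
  all brackets are positive, the product on the left exceeds each product on the right.\<close>

lemma Delta_pluecker:
  "Delta o' a c * Delta o' b d = Delta o' a b * Delta o' c d + Delta o' a d * Delta o' b c"
  unfolding Delta_eq by algebra

lemma Delta_affine:
  assumes "u + v = 1"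
  shows "Delta (u *\<^sub>R a + v *\<^sub>R b) c d = u * Delta a c d + v * Delta b c d"
proof -
  have v: "v = 1 - u" using assms by simp
  show ?thesis unfolding v Delta_eq by (simp add: algebra_simps)
qed

text \<open>An algebraic counterpart of \<open>proper\<close>: all triples of increasing indices
  have the same orientation. For \<open>k >= 3\<close> the two are equivalent, and this form visibly
  passes to subsequences.\<close>

definition positively_ordered :: "nat \<Rightarrow> (nat \<Rightarrow> real^2) \<Rightarrow> bool" where
  "positively_ordered k w \<longleftrightarrow>
     (\<forall>a b c. 1 \<le> a \<and> a < b \<and> b < c \<and> c \<le> k \<longrightarrow> Delta (w a) (w b) (w c) > 0)"

section \<open>From positive brackets to edges of the convex hull\<close>

lemma convex_Delta_pos: "convex {x. Delta x a b > 0}"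
  unfolding convex_alt
proof (intro ballI allI impI, unfold mem_Collect_eq)
  fix x y and u :: real assume h: "0 < Delta x a b" "0 < Delta y a b" "0 \<le> u \<and> u \<le> 1"
  have "(1-u) * Delta x a b + u * Delta y a b > 0"
  proof (cases "u = 0")
    case False
    then show ?thesis using h by (intro add_nonneg_pos mult_nonneg_nonneg mult_pos_pos) auto
  qed (use h in auto)
  then show "0 < Delta ((1 - u) *\<^sub>R x + u *\<^sub>R y) a b" by (simp add: Delta_affine)
qed

lemma affine_hull_eq_Delta_zero:
  assumes "c \<noteq> d"
  shows "affine hull {c, d} = {x. Delta x c d = 0}"
proof
  show "affine hull {c, d} \<subseteq> {x. Delta x c d = 0}"
    by (auto simp: affine_hull_2 Delta_affine)
  show "{x. Delta x c d = 0} \<subseteq> affine hull {c, d}"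
  proof
    fix x assume "x \<in> {x. Delta x c d = 0}"
    then have D: "(x $ 1 - c $ 1) * (d $ 2 - c $ 2) = (x $ 2 - c $ 2) * (d $ 1 - c $ 1)"
      by (simp add: Delta_eq)
    have "\<exists>u. x = (1 - u) *\<^sub>R c + u *\<^sub>R d"
    proof (cases "d $ 1 = c $ 1")
      case True
      with assms have d: "d $ 2 - c $ 2 \<noteq> 0" by (auto simp: vec_eq_iff forall_2)
      define u where "u = (x $ 2 - c $ 2) / (d $ 2 - c $ 2)"
      have "x $ 1 = c $ 1" using D True d by simp
      moreover have "x $ 2 = c $ 2 + u * (d $ 2 - c $ 2)" using d by (simp add: u_def)
      ultimately have "x = (1 - u) *\<^sub>R c + u *\<^sub>R d"
        using True by (simp add: vec_eq_iff forall_2 algebra_simps)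
      then show ?thesis ..
    next
      case False
      then have d: "d $ 1 - c $ 1 \<noteq> 0" by simp
      define u where "u = (x $ 1 - c $ 1) / (d $ 1 - c $ 1)"
      have "x $ 1 = c $ 1 + u * (d $ 1 - c $ 1)" using d by (simp add: u_def)
      moreover have "x $ 2 = c $ 2 + u * (d $ 2 - c $ 2)"
        using d D by (simp add: u_def field_simps)
      ultimately have "x = (1 - u) *\<^sub>R c + u *\<^sub>R d"
        by (simp add: vec_eq_iff forall_2 algebra_simps)
      then show ?thesis ..
    qed
    then obtain u where "x = (1 - u) *\<^sub>R c + u *\<^sub>R d" ..
    then show "x \<in> affine hull {c, d}"
      unfolding affine_hull_2 by (intro CollectI exI[of _ "1 - u"] exI[of _ u]) simp
  qed
qed

text \<open>The line through \<open>a\<close> and \<open>b\<close> misses the convex hull of the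
  remaining points, since these lie in an open half-plane beside it.\<close>

lemma edge_of_convex_hull_if_Delta_pos:
  assumes "finite X" "a \<in> X" "b \<in> X" "a \<noteq> b"
    and pos: "\<And>x. x \<in> X - {a, b} \<Longrightarrow> Delta x a b > 0"
  shows "(convex hull {a, b}) edge_of (convex hull X)"
proof -
  have "affine hull {a, b} = {x. Delta x a b = 0}"
    using \<open>a \<noteq> b\<close> by (rule affine_hull_eq_Delta_zero)
  moreover have "convex hull (X - {a, b}) \<subseteq> {x. Delta x a b > 0}"
    by (rule hull_minimal) (use pos convex_Delta_pos in auto)
  ultimately have "affine hull {a, b} \<inter> convex hull (X - {a, b}) = {}" by fastforce
  then have "(convex hull {a, b}) face_of (convex hull X)"
    using assms by (intro face_of_convex_hulls) auto
  moreover have "aff_dim (convex hull {a, b}) = 1"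
    using \<open>a \<noteq> b\<close> by (simp add: aff_dim_convex_hull aff_dim_2)
  ultimately show ?thesis by (simp add: edge_of_def)
qed

text \<open>Rotating a bracket until its indices increase shows that all other vertices lie strictly
  on one side of each edge, including the closing one.\<close>

lemma proper_if_positively_ordered:
  assumes k: "3 \<le> k" and ord: "positively_ordered k w"
  shows "proper k w"
  unfolding proper_def
proof (intro conjI ballI)
  have pos: "Delta (w a) (w b) (w c) > 0" if "1 \<le> a" "a < b" "b < c" "c \<le> k" for a b c
    using ord that by (auto simp: positively_ordered_def)
  have neq: "w a \<noteq> w b" if ab: "1 \<le> a" "a < b" "b \<le> k" for a b
  proof -
    \<comment> \<open>A third index completes the pair to a triple whose bracket would vanish if the
      two points coincided.\<close>
    consider "b < k" | "1 < a" | "a = 1" "b = k" using ab by linarith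
    then show ?thesis
    proof cases
      case 1 then show ?thesis using pos[of a b k] ab by auto
    next
      case 2 then show ?thesis using pos[of 1 a b] ab by auto
    next
      case 3 then show ?thesis using pos[of 1 2 k] k by auto
    qed
  qed
  show inj: "inj_on w {1..k}"
  proof (rule inj_onI)
    fix a b assume "a \<in> {1..k}" "b \<in> {1..k}" "w a = w b"
    then show "a = b" using neq[of a b] neq[of b a] by (metis atLeastAtMost_iff linorder_neqE_nat)
  qed
  show "0 < Delta (w 1) (w 2) (w 3)" using pos[of 1 2 3] k by simp
  fix j assume j: "j \<in> {1..k}"
  have sj: "cyc_suc k j \<in> {1..k}" "cyc_suc k j \<noteq> j" using j k by (auto simp: cyc_suc_def)
  show "convex hull {w j, w (cyc_suc k j)} edge_of convex hull w ` {1..k}"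
  proof (rule edge_of_convex_hull_if_Delta_pos)
    show "w j \<noteq> w (cyc_suc k j)" using inj sj j by (metis inj_onD)
    fix x assume "x \<in> w ` {1..k} - {w j, w (cyc_suc k j)}"
    then obtain i where i: "x = w i" "1 \<le> i" "i \<le> k" "i \<noteq> j" "i \<noteq> cyc_suc k j" by fastforce
    show "0 < Delta x (w j) (w (cyc_suc k j))"
    proof (cases "j = k")
      case True
      then show ?thesis using pos[of 1 i k] i Delta_rotate[of "w 1" "w i" "w k"]
        by (simp add: cyc_suc_def)
    next
      case False
      then have s: "cyc_suc k j = j + 1" by (simp add: cyc_suc_def)
      show ?thesis
      proof (cases "i < j")
        case True
        then show ?thesis using pos[of i j "j+1"] i j False s by simp
      next
        case f2: False
        then show ?thesis using pos[of j "j+1" i] i j s Delta_rotate[of "w i" "w j" "w (j+1)"]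
          by simp
      qed
    qed
  qed (use j sj in auto)
qed (use k in auto)

section \<open>From edges of the convex hull to positive brackets\<close>

lemma proper_distinct:
  assumes "proper k w" "a \<in> {1..k}" "b \<in> {1..k}" "a \<noteq> b"
  shows "w a \<noteq> w b"
proof -
  have "inj_on w {1..k}" using assms(1) unfolding proper_def by blast
  then show ?thesis using assms by (meson inj_onD)
qed

lemma proper_cyc_suc:
  assumes "proper k w" "j \<in> {1..k}"
  shows "cyc_suc k j \<in> {1..k}" "cyc_suc k j \<noteq> j"
proof -
  have "3 \<le> k" using assms(1) unfolding proper_def by blast
  then show "cyc_suc k j \<in> {1..k}" "cyc_suc k j \<noteq> j" using assms(2) by (auto simp: cyc_suc_def)
qed

lemma proper_face:
  assumes "proper k w" "j \<in> {1..k}"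
  shows "(convex hull {w j, w (cyc_suc k j)}) face_of (convex hull (w ` {1..k}))"
  using assms unfolding proper_def edge_of_def by blast

text \<open>A face is the intersection of its affine hull with the polygon, and the affine hull of
  an edge is the zero set of its bracket.\<close>

lemma proper_edge_iff_Delta_zero:
  assumes "proper k w" "j \<in> {1..k}" "x \<in> convex hull (w ` {1..k})"
  shows "x \<in> convex hull {w j, w (cyc_suc k j)} \<longleftrightarrow> Delta x (w j) (w (cyc_suc k j)) = 0"
proof -
  have "convex hull {w j, w (cyc_suc k j)} =
      affine hull {w j, w (cyc_suc k j)} \<inter> convex hull (w ` {1..k})"
    using face_of_imp_eq_affine_Int[OF _ proper_face[OF assms(1,2)]]
    by (simp add: affine_hull_convex_hull)
  moreover have "w j \<noteq> w (cyc_suc k j)"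
    using proper_distinct[OF assms(1,2)] proper_cyc_suc[OF assms(1,2)] by metis
  ultimately show ?thesis using assms(3) by (auto simp: affine_hull_eq_Delta_zero)
qed

text \<open>A vertex in the relative interior of an edge would also be an end point of its own edge, which,
  being a face, contains the first edge.\<close>
lemma proper_not_collinear:
  assumes "proper k w" "j \<in> {1..k}" "i \<in> {1..k}" "i \<noteq> j" "i \<noteq> cyc_suc k j"
  shows "Delta (w i) (w j) (w (cyc_suc k j)) \<noteq> 0"
proof
  let ?s = "cyc_suc k"
  let ?P = "convex hull (w ` {1..k})"
  assume D0: "Delta (w i) (w j) (w (?s j)) = 0"
  have inP: "w l \<in> ?P" if "l \<in> {1..k}" for l using that by (simp add: hull_inc)
  have sj: "?s j \<in> {1..k}" using proper_cyc_suc assms by blast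
  have "w i \<in> convex hull {w j, w (?s j)}"
    using proper_edge_iff_Delta_zero[OF assms(1,2) inP[OF assms(3)]] D0 by simp
  moreover have "w i \<noteq> w j" "w i \<noteq> w (?s j)"
    using proper_distinct[OF assms(1,3)] assms sj by blast+
  ultimately have opn: "w i \<in> open_segment (w j) (w (?s j))"
    by (simp add: open_segment_def segment_convex_hull)
  have "w i \<in> convex hull {w i, w (?s i)}" by (simp add: hull_inc)
  then have "w j \<in> convex hull {w i, w (?s i)}" "w (?s j) \<in> convex hull {w i, w (?s i)}"
    using face_ofD[OF proper_face[OF assms(1,3)] opn] inP[OF assms(2)] inP[OF sj] by blast+
  moreover have "(w i) extreme_point_of (convex hull {w i, w (?s i)})"
    by (metis extreme_point_of_segment segment_convex_hull)
  ultimately show False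
    using opn unfolding extreme_point_of_def by blast
qed

text \<open>Otherwise the segment between two vertices on opposite sides would cross the edge line
  inside the polygon, hence on the edge; the face property would then put its end points on the
  edge.\<close>

lemma proper_same_side:
  assumes "proper k w" "j \<in> {1..k}" "i \<in> {1..k}" "l \<in> {1..k}"
    "0 < Delta (w i) (w j) (w (cyc_suc k j))" "l \<noteq> j" "l \<noteq> cyc_suc k j"
  shows "0 < Delta (w l) (w j) (w (cyc_suc k j))"
proof (rule ccontr)
  let ?s = "cyc_suc k"
  let ?P = "convex hull (w ` {1..k})"
  let ?D = "\<lambda>x. Delta x (w j) (w (?s j))"
  assume "\<not> 0 < ?D (w l)"
  moreover have "?D (w l) \<noteq> 0" using proper_not_collinear assms by blast
  ultimately have neg: "?D (w l) < 0" by linarith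
  \<comment> \<open>The parameter at which the affine function \<open>?D\<close> vanishes on the
    segment from \<open>w i\<close> to \<open>w l\<close>.\<close>
  define t where "t = ?D (w i) / (?D (w i) - ?D (w l))"
  define z where "z = (1 - t) *\<^sub>R w i + t *\<^sub>R w l"
  have t: "0 < t" "t < 1" using neg assms(5) by (auto simp: t_def field_simps)
  have "?D z = (1 - t) * ?D (w i) + t * ?D (w l)"
    unfolding z_def by (rule Delta_affine) simp
  also have "\<dots> = ?D (w i) - t * (?D (w i) - ?D (w l))" by (simp add: algebra_simps)
  also have "\<dots> = 0" using neg assms(5) by (simp add: t_def)
  finally have Dz: "?D z = 0" .
  have "w i \<noteq> w l" using neg assms(5) by auto
  then have zo: "z \<in> open_segment (w i) (w l)"
    using t by (auto simp: in_segment z_def)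
  have inP: "w l \<in> ?P" if "l \<in> {1..k}" for l using that by (simp add: hull_inc)
  have "z \<in> ?P"
    unfolding z_def by (rule convexD_alt) (use inP assms t in auto)
  then have "z \<in> convex hull {w j, w (?s j)}"
    using proper_edge_iff_Delta_zero[OF assms(1,2)] Dz by blast
  then have "w i \<in> convex hull {w j, w (?s j)}"
    using face_ofD[OF proper_face[OF assms(1,2)] zo] inP assms(3,4) by blast
  then show False
    using proper_edge_iff_Delta_zero[OF assms(1,2) inP[OF assms(3)]] assms(5) by simp
qed

text \<open>The orientation of the first edge spreads to all but the closing one, since edges
  \<open>j\<close> and \<open>j+1\<close> share the triple \<open>j, j+1, j+2\<close>. Pluecker
  relations then extend positivity to all triples.\<close>

lemma proper_imp_positively_ordered:
  assumes "proper k w"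
  shows "positively_ordered k w"
proof -
  have k: "3 \<le> k" and D1: "Delta (w 1) (w 2) (w 3) > 0" using assms by (auto simp: proper_def)
  have side: "0 < Delta (w l) (w j) (w (j+1))"
    if "1 \<le> j" "j < k" "1 \<le> i" "i \<le> k" "1 \<le> l" "l \<le> k" "0 < Delta (w i) (w j) (w (j+1))"
      "l \<noteq> j" "l \<noteq> j+1" for i j l
    using proper_same_side[of k w j i l] assms that by (auto simp: cyc_suc_def)
  have edge: "1 \<le> j \<Longrightarrow> j < k \<Longrightarrow>
      \<forall>l. 1 \<le> l \<and> l \<le> k \<and> l \<noteq> j \<and> l \<noteq> j+1 \<longrightarrow> 0 < Delta (w l) (w j) (w (j+1))" for j
  proof (induction j rule: nat_induct_at_least[of 1, consumes 1, case_names base step])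
    case base
    have "0 < Delta (w 3) (w 1) (w (1+1))"
      using D1 Delta_rotate[of "w 3" "w 1" "w 2"] by (simp add: numeral_2_eq_2)
    then show ?case using side[of 1 3] k
      by (metis One_nat_def le_refl less_le_trans numeral_3_eq_3 lessI one_le_numeral base)
  next
    case (step j)
    then have "0 < Delta (w (j+2)) (w j) (w (j+1))" by auto
    then have "0 < Delta (w j) (w (Suc j)) (w (Suc j + 1))"
      using Delta_rotate[of "w (j+2)" "w j" "w (j+1)"] by simp
    then show ?case using side[of "Suc j" j] step by auto
  qed
  have main: "Delta (w a) (w b) (w c) > 0" if a: "1 \<le> a" "a < b" and bc: "b < c" "c \<le> k" for a b c
    using bc
  proof (induction c rule: less_induct)
    case (less c)
    have first: "Delta (w a) (w (a+1)) (w d) > 0" if "a + 1 < d" "d \<le> k" for d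
      using edge[of a] a that Delta_rotate[of "w d" "w a" "w (a+1)"]
      by (metis le_less_trans less_imp_le_nat less_le_trans not_less_iff_gr_or_eq order_less_trans
          le_add1)
    show ?case
    proof (cases "b = a + 1 \<or> c = b + 1")
      case True
      then show ?thesis using first[of c] less.prems edge[of b] a by auto
    next
      case False
      \<comment> \<open>In the Pluecker relation centred at \<open>a\<close>, with \<open>d\<close>
        the predecessor of \<open>c\<close>, each bracket on the right either contains an edge or is
        \<open>a, b, d\<close>, where the induction hypothesis applies.\<close>
      define d where "d = c - 1"
      have d: "c = d + 1" "b < d" "a + 1 < b" using False less.prems a by (auto simp: d_def)
      have "Delta (w a) (w (a+1)) (w d) * Delta (w a) (w b) (w c)
          = Delta (w a) (w (a+1)) (w b) * Delta (w a) (w d) (w c)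
            + Delta (w a) (w (a+1)) (w c) * Delta (w a) (w b) (w d)"
        by (rule Delta_pluecker)
      moreover have "Delta (w a) (w d) (w c) > 0" using edge[of d] d a less.prems by auto
      moreover have "Delta (w a) (w b) (w d) > 0" using less d by auto
      ultimately have "0 < Delta (w a) (w (a+1)) (w d) * Delta (w a) (w b) (w c)"
        using first[of b] first[of c] d less.prems by (auto intro!: add_pos_pos mult_pos_pos)
      then show ?thesis using first[of d] d less.prems zero_less_mult_pos by auto
    qed
  qed
  then show ?thesis by (auto simp: positively_ordered_def)
qed

section \<open>Inequalities between brackets\<close>

lemma positively_orderedD:
  assumes "positively_ordered k w" "1 \<le> a" "a < b" "b < c" "c \<le> k"
  shows "0 < Delta (w a) (w b) (w c)"
  using assms by (auto simp: positively_ordered_def)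

text \<open>These are the Pluecker relations centred at the inner points \<open>b\<close>,
  \<open>c\<close> and \<open>d\<close>, each with one positive product dropped.\<close>

lemma positively_ordered_pluecker:
  assumes ord: "positively_ordered k w"
    and le: "1 \<le> a" "a < b" "b < c" "c < d" "d < e" "e \<le> k"
  defines "T \<equiv> \<lambda>x y z. Delta (w x) (w y) (w z)"
  shows "T a b c * T b d e < T b c e * T a b d"
    and "T a b c * T c d e < T a c d * T b c e"
    and "T a b d * T c d e < T b d e * T a c d"
proof -
  have rot: "T x y z = T y z x" for x y z unfolding T_def by (rule Delta_rotate)
  have pl: "T x y1 y3 * T x y2 y4 = T x y1 y2 * T x y3 y4 + T x y1 y4 * T x y2 y3" for x y1 y2 y3 y4
    unfolding T_def by (rule Delta_pluecker)
  have pos: "T x y z > 0" if "1 \<le> x" "x < y" "y < z" "z \<le> k" for x y z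
    unfolding T_def using positively_orderedD[OF ord] that .
  have "T b c d > 0" "T a b e > 0" "T a c e > 0" "T a d e > 0"
    using le by (auto intro!: pos)
  then have "T b c d * T a b e > 0" "T b c d * T a c e > 0" "T b c d * T a d e > 0"
    by simp_all
  moreover have "T b c e * T a b d = T b c d * T a b e + T a b c * T b d e"
    using pl[of b c e d a] by (simp only: rot[of a b d] rot[of a b e] rot[of a b c])
  moreover have "T a c d * T b c e = T c d e * T a b c + T b c d * T a c e"
    using pl[of c d a e b]
    by (simp only: rot[of a c d] rot[of b c e] rot[of c a b, symmetric] rot[of b c d] rot[of a c e])
  moreover have "T b d e * T a c d = T a d e * T b c d + T c d e * T a b d"
    using pl[of d e b a c]
    by (simp only: rot[of b d e] rot[of d a c, symmetric] rot[of a d e] rot[of d b c, symmetric]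
        rot[of c d e] rot[of d a b, symmetric])
  ultimately show "T a b c * T b d e < T b c e * T a b d"
    and "T a b c * T c d e < T a c d * T b c e"
    and "T a b d * T c d e < T b d e * T a c d"
    by (simp_all add: mult.commute)
qed

text \<open>Chains \<open>a / c <= d / b\<close> with \<open>d / b < f / e\<close> in product
  form.\<close>

lemma mult_less_chain:
  fixes a b c d e f :: real
  assumes "a * b \<le> c * d" "d * e < b * f" "0 < a" "0 < d" "0 < f"
  shows "a * e < c * f"
proof -
  have "a * (d * e) < a * (b * f)" using assms by simp
  also have "\<dots> = (a * b) * f" by simp
  also have "\<dots> \<le> (c * d) * f" using assms by (intro mult_right_mono) auto
  finally have "d * (a * e) < d * (c * f)" by (simp add: algebra_simps)
  then show ?thesis using assms by simp
qed

text \<open>Chains Pluecker inequalities centred at \<open>c\<close> and at \<open>d\<close>; for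
  \<open>c = d\<close> a single one suffices. This covers the instances of admissibility in which
  \<open>t\<close> precedes and \<open>q\<close> follows both edges.\<close>

lemma positively_ordered_outer:
  assumes ord: "positively_ordered k w"
    and le: "1 \<le> a" "a < b" "b < c" "c \<le> d" "d < e" "e < f" "f \<le> k"
  defines "T \<equiv> \<lambda>x y z. Delta (w x) (w y) (w z)"
  shows "T a b c * T d e f < T a d e * T b c f"
proof (cases "c = d")
  case True
  then show ?thesis
    using positively_ordered_pluecker(2)[OF ord, of a b c e f] le by (simp add: T_def)
next
  case False
  have "T d e f * T a b c < T a d e * T b c f"
  proof (rule mult_less_chain)
    show "T d e f * T a c d \<le> T a d e * T c d f"
      using positively_ordered_pluecker(2)[OF ord, of a c d e f] le False by (simp add: T_def mult.commute)
    show "T c d f * T a b c < T a c d * T b c f"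
      using positively_ordered_pluecker(2)[OF ord, of a b c d f] le False by (simp add: T_def mult.commute)
  qed (use positively_orderedD[OF ord] le False in \<open>auto simp: T_def\<close>)
  then show ?thesis by (simp add: mult.commute)
qed

text \<open>The points 1 to 6 end up with \<alpha> \<ge> \<beta> > \<gamma> > \<alpha>. Taking 8 as
  the last point of a shifted sextuple yields \<beta> > \<gamma> on the points 1 to 7; its instance
  on 2 to 7, combined with point 1, yields \<gamma> > \<alpha>.\<close>

lemma not_all_alpha_ge_beta:
  assumes ord: "positively_ordered 8 w"
  defines "T \<equiv> \<lambda>x y z. Delta (w x) (w y) (w z)"
  assumes ge: "\<And>a b c d e f. \<lbrakk>1 \<le> a; a < b; b < c; c < d; d < e; e < f; f \<le> 8\<rbrakk> \<Longrightarrow>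
    T b c d * T a e f \<le> T a b c * T d e f"
  shows False
proof -
  have pos: "0 < T a b c" if "1 \<le> a" "a < b" "b < c" "c \<le> 8" for a b c
    unfolding T_def using positively_orderedD[OF ord] that .
  have beta_gamma: "T c d e * T a b f < T b c d * T a e f"
    if "1 \<le> a" "a < b" "b < c" "c < d" "d < e" "e < f" "f < 8" for a b c d e f
  proof (rule mult_less_chain)
    show "T c d e * T b f 8 \<le> T b c d * T e f 8"
      using ge[of b c d e f 8] that by simp
    show "T e f 8 * T a b f < T b f 8 * T a e f"
      using positively_ordered_pluecker(3)[OF ord, of a b e f 8] that
      by (simp add: T_def mult.commute)
  qed (use that in \<open>auto intro!: pos\<close>)
  have "T 4 5 6 * T 1 2 3 < T 3 4 5 * T 1 2 6"
  proof (rule mult_less_chain)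
    show "T 4 5 6 * T 2 3 7 \<le> T 3 4 5 * T 2 6 7" using beta_gamma[of 2 3 4 5 6 7] by simp
    show "T 2 6 7 * T 1 2 3 < T 2 3 7 * T 1 2 6"
      using positively_ordered_pluecker(1)[OF ord, of 1 2 3 6 7] by (simp add: T_def mult.commute)
  qed (auto intro!: pos)
  then show False
    using beta_gamma[of 1 2 3 4 5 6] ge[of 1 2 3 4 5 6] by (simp add: mult.commute)
qed

text \<open>Reversing the indices swaps \<beta> and \<gamma>. Point 1 now serves as the auxiliary
  first point, and the contradiction arises on the points 3 to 8.\<close>

lemma not_all_alpha_ge_gamma:
  assumes ord: "positively_ordered 8 w"
  defines "T \<equiv> \<lambda>x y z. Delta (w x) (w y) (w z)"
  assumes ge: "\<And>a b c d e f. \<lbrakk>1 \<le> a; a < b; b < c; c < d; d < e; e < f; f \<le> 8\<rbrakk> \<Longrightarrow>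
    T c d e * T a b f \<le> T a b c * T d e f"
  shows False
proof -
  have pos: "0 < T a b c" if "1 \<le> a" "a < b" "b < c" "c \<le> 8" for a b c
    unfolding T_def using positively_orderedD[OF ord] that .
  have gamma_beta: "T b c d * T a e f < T c d e * T a b f"
    if "1 < a" "a < b" "b < c" "c < d" "d < e" "e < f" "f \<le> 8" for a b c d e f
  proof (rule mult_less_chain)
    show "T b c d * T 1 a e \<le> T c d e * T 1 a b"
      using ge[of 1 a b c d e] that by (simp add: mult.commute)
    show "T 1 a b * T a e f < T 1 a e * T a b f"
      using positively_ordered_pluecker(1)[OF ord, of 1 a b e f] that
      by (simp add: T_def mult.commute)
  qed (use that in \<open>auto intro!: pos\<close>)
  have "T 3 4 5 * T 6 7 8 < T 4 5 6 * T 3 7 8"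
  proof (rule mult_less_chain)
    show "T 3 4 5 * T 2 6 7 \<le> T 4 5 6 * T 2 3 7" using gamma_beta[of 2 3 4 5 6 7] by simp
    show "T 2 3 7 * T 6 7 8 < T 2 6 7 * T 3 7 8"
      using positively_ordered_pluecker(3)[OF ord, of 2 3 6 7 8] by (simp add: T_def mult.commute)
  qed (auto intro!: pos)
  then show False
    using gamma_beta[of 3 4 5 6 7 8] ge[of 3 4 5 6 7 8] by (simp add: mult.commute)
qed

text \<open>The six points are \<open>t\<close>, \<open>q\<close> and the ends of the edges starting
  at \<open>r\<close> and \<open>p\<close>. The right-hand side vanishes if \<open>t\<close> is an
  end of the edge at \<open>r\<close> or \<open>q\<close> one of the edge at \<open>p\<close>;
  otherwise the order of the points selects the inequality.\<close>

lemma admissible_if_alpha_minimal: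
  assumes k: "3 \<le> k" and ord: "positively_ordered k w"
  defines "T \<equiv> \<lambda>x y z. Delta (w x) (w y) (w z)"
  assumes beta: "\<And>a b c d e f. \<lbrakk>1 \<le> a; a < b; b < c; c < d; d < e; e < f; f \<le> k\<rbrakk> \<Longrightarrow>
      T a b c * T d e f < T b c d * T a e f"
    and gamma: "\<And>a b c d e f. \<lbrakk>1 \<le> a; a < b; b < c; c < d; d < e; e < f; f \<le> k\<rbrakk> \<Longrightarrow>
      T a b c * T d e f < T c d e * T a b f"
  shows "admissible k w"
  unfolding admissible_def
proof (intro conjI ballI impI)
  show "proper k w" using k ord by (rule proper_if_positively_ordered)
  fix p q r t
  assume "p \<in> {1..k}" and q: "q \<in> {1..k}" and r: "r \<in> {1..k}" and t: "t \<in> {1..k}"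
    and "p < k \<and> (min p (q - 1) > r \<and> r > t \<or> q > p \<and> p > max r t)"
  then have pk: "p < k" and cond: "r < p \<and> r + 1 < q \<and> t < r \<or> p < q \<and> r < p \<and> t < p"
    by auto
  have pos: "0 < T a b c" if "1 \<le> a" "a < b" "b < c" "c \<le> k" for a b c
    unfolding T_def using positively_orderedD[OF ord] that .
  have rot: "T a b c = T b c a" for a b c unfolding T_def by (rule Delta_rotate)
  have zero: "T a a b = 0" "T a b a = 0" for a b unfolding T_def by simp_all
  \<comment> \<open>Since \<open>r < p < k\<close>, neither column belongs to the closing
    edge.\<close>
  have slack: "slack k w a j = T a j (j + 1)" if "j < k" for a j
    using that by (simp add: slack_def cyc_suc_def T_def)
  have tp: "0 < T t p (p + 1)" using cond pk t by (intro pos) auto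
  have qr: "0 < T q r (r + 1)" using cond r q unfolding rot[of q] by (intro pos) auto
  \<comment> \<open>The last three cases use, in this order, \<alpha> < \<beta>, the unconditional
    inequality, and \<alpha> < \<gamma>.\<close>
  consider "q = p \<or> q = p + 1" | "t = r \<or> t = r + 1"
    | "t < r" "r + 1 < q" "q < p" | "t < r" "r < p" "p + 1 < q" | "r + 1 < t" "t < p" "p + 1 < q"
    using cond by linarith
  then have "T q p (p + 1) * T t r (r + 1) < T t p (p + 1) * T q r (r + 1)"
  proof cases
    case 1
    then have "T q p (p + 1) = 0" using zero by blast
    then show ?thesis using tp qr by simp
  next
    case 2
    then have "T t r (r + 1) = 0" using zero by blast
    then show ?thesis using tp qr by simp
  next
    case 3
    then show ?thesis
      using beta[of t r "r + 1" q p "p + 1"] pk t rot[of q r "r + 1"] by (simp add: mult.commute)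
  next
    case 4
    then show ?thesis
      using positively_ordered_outer[OF ord, of t r "r + 1" p "p + 1" q] q t
        rot[of q p "p + 1"] rot[of q r "r + 1"]
      by (simp add: mult.commute T_def)
  next
    case 5
    then show ?thesis
      using gamma[of r "r + 1" t p "p + 1" q] q r
        rot[of q p "p + 1"] rot[of q r "r + 1"] rot[of t r "r + 1"]
      by (simp add: mult.commute)
  qed
  then show "slack k w q p * slack k w t r < slack k w t p * slack k w q r"
    using slack[OF pk] slack[of r] pk cond by auto
qed

section \<open>The numerical bound\<close>

text \<open>One level of the tower bound, with \<open>b\<close> spare bits absorbing
  \<open>c\<close> and \<open>d\<close>. The affine left-hand side is the form in which the second
  premise is needed one level up.\<close>

lemma mult_power_8_le:
  fixes c d r e b j :: nat
  assumes "c + d \<le> 2 ^ b" "3 * j * r + b \<le> e"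
  shows "c * (8 ^ r) ^ j + d \<le> 2 ^ e"
proof -
  have pow: "(8 ^ r) ^ j = (2::nat) ^ (3 * j * r)"
  proof -
    have "(8::nat) = 2 ^ 3" by simp
    then show ?thesis by (simp only: power_mult[symmetric] ac_simps)
  qed
  have "c * (8 ^ r) ^ j + d \<le> c * (8 ^ r) ^ j + d * (8 ^ r) ^ j" by simp
  also have "\<dots> = (c + d) * (8 ^ r) ^ j" by (simp add: algebra_simps)
  also have "\<dots> \<le> 2 ^ b * (8 ^ r) ^ j" using assms by simp
  also have "2 ^ b * (8 ^ r) ^ j = (2::nat) ^ (3 * j * r + b)"
    by (simp only: pow power_add mult.commute)
  also have "\<dots> \<le> 2 ^ e" using assms by (intro power_increasing) auto
  finally show ?thesis .
qed

text \<open>The left-hand side is \<open>3 * 3 * (4 * n)^2 + 5\<close>, the exponent at the bottom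
  of the tower. By \<open>Suc n <= 2 * n\<close> it grows at most fourfold per step.\<close>

lemma quadratic_le_6_power:
  assumes "20 \<le> n"
  shows "144 * n ^ 2 + 5 \<le> (6::nat) ^ n"
  using assms
proof (induction n rule: nat_induct_at_least)
  case (Suc n)
  have "Suc n ^ 2 \<le> (2 * n) ^ 2" using Suc by (intro power_mono) auto
  then show ?case using Suc by (simp add: power_mult_distrib)
qed simp

text \<open>Five Erdos-Rado steps starting from the pigeonhole bound \<open>4 * n\<close>; the base
  8 is twice the number of colours.\<close>

lemma arrows_6:
  assumes "20 \<le> n" and X: "X = (2::nat) ^ (6 ^ (2 ^ (6 ^ n)))"
  shows "\<exists>N. arrows 4 6 n N \<and> N \<le> 2 ^ (2 ^ X)"
proof -
  define R1 where "R1 = 4 * n"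
  define R2 where "R2 = (8::nat) ^ (R1 ^ 2)"
  define R3 where "R3 = (8::nat) ^ (R2 ^ 3)"
  define R4 where "R4 = (8::nat) ^ (R3 ^ 4)"
  define R5 where "R5 = (8::nat) ^ (R4 ^ 5)"
  define R6 where "R6 = (8::nat) ^ (R5 ^ 6)"
  have a1: "arrows 4 1 n R1" unfolding R1_def by (rule arrows_1)
  have a2: "arrows 4 2 n R2" using arrows_Suc[OF a1] by (simp add: R2_def numeral_2_eq_2)
  have a3: "arrows 4 3 n R3" using arrows_Suc[OF a2] by (simp add: R3_def)
  have a4: "arrows 4 4 n R4" using arrows_Suc[OF a3] by (simp add: R4_def)
  have a5: "arrows 4 5 n R5" using arrows_Suc[OF a4] by (simp add: R5_def)
  have a6: "arrows 4 6 n R6" using arrows_Suc[OF a5] by (simp add: R6_def)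
  have "3 * 3 * R1 ^ 2 + 5 \<le> 6 ^ n"
    using quadratic_le_6_power[OF assms(1)] by (simp add: R1_def power_mult_distrib)
  then have "12 * R2 ^ 3 + 5 \<le> 2 ^ (6 ^ n)"
    unfolding R2_def by (rule mult_power_8_le[rotated]) simp
  then have "3 * 4 * R2 ^ 3 + 5 \<le> 2 ^ (6 ^ n)" by simp
  then have "15 * R3 ^ 4 + 5 \<le> 2 ^ (2 ^ (6 ^ n))"
    unfolding R3_def by (rule mult_power_8_le[rotated]) simp
  \<comment> \<open>The base is raised from 2 to 6 to match the shape of \<open>X\<close>.\<close>
  also have "\<dots> \<le> 6 ^ (2 ^ (6 ^ n))" by (rule power_mono) auto
  finally have "3 * 5 * R3 ^ 4 + 5 \<le> 6 ^ (2 ^ (6 ^ n))" by simp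
  then have "18 * R4 ^ 5 + 2 \<le> X"
    unfolding R4_def X by (rule mult_power_8_le[rotated]) simp
  then have "3 * 6 * R4 ^ 5 + 2 \<le> X" by simp
  then have "3 * R5 ^ 6 + 0 \<le> 2 ^ X"
    unfolding R5_def by (rule mult_power_8_le[rotated]) simp
  then have "3 * 1 * R5 ^ 6 + 0 \<le> 2 ^ X" by simp
  then have "1 * R6 ^ 1 + 0 \<le> 2 ^ (2 ^ X)"
    unfolding R6_def by (rule mult_power_8_le[rotated]) simp
  with a6 show ?thesis by auto
qed

lemma two_power_le_exp: "(2::real) ^ N \<le> exp (real N)"
proof -
  have "(2::real) \<le> exp 1" using exp_ge_add_one_self[of 1] by simp
  then have "(2::real) ^ N \<le> exp 1 ^ N" by (intro power_mono) auto
  then show ?thesis by (simp add: exp_of_nat_mult[symmetric])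
qed

section \<open>Extraction of the admissible subsequence\<close>

theorem theorem5p7:
  fixes n m :: nat and x :: real and v :: "nat \<Rightarrow> real^2"
  assumes "n \<ge> 20"
    and "x = 2 ^ (6 ^ (2 ^ (6 ^ n)))"
    and "real m > exp (exp (3 * x))"
    and "proper m v"
  shows "\<exists>i :: nat \<Rightarrow> nat. strict_mono_on {1..n} i \<and> i ` {1..n} \<subseteq> {1..m} \<and> admissible n (v \<circ> i)"
proof -
  define X :: nat where "X = 2 ^ (6 ^ (2 ^ (6 ^ n)))"
  have x: "x = real X" by (simp add: assms(2) X_def)
  obtain N where N: "arrows 4 6 n N" "N \<le> 2 ^ (2 ^ X)"
    using arrows_6[OF assms(1) X_def] by blast
  have "real N \<le> real (2 ^ (2 ^ X))" using N(2) by (rule of_nat_mono)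
  also have "\<dots> = 2 ^ (2 ^ X)" by simp
  also have "\<dots> \<le> exp (real (2 ^ X))" by (rule two_power_le_exp)
  also have "real (2 ^ X) = 2 ^ X" by simp
  also have "exp (2 ^ X) \<le> exp (exp (3 * x))"
  proof -
    have "(2::real) ^ X \<le> exp (real X)" by (rule two_power_le_exp)
    also have "\<dots> \<le> exp (3 * x)" by (simp add: x)
    finally show ?thesis by simp
  qed
  finally have "N \<le> m" using assms(3) by linarith
  have ordv: "positively_ordered m v" using assms(4) by (rule proper_imp_positively_ordered)
  define beta_cond where "beta_cond l \<longleftrightarrow>
      Delta (v (l!0)) (v (l!1)) (v (l!2)) * Delta (v (l!3)) (v (l!4)) (v (l!5))
      < Delta (v (l!1)) (v (l!2)) (v (l!3)) * Delta (v (l!0)) (v (l!4)) (v (l!5))" for l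
  define gamma_cond where "gamma_cond l \<longleftrightarrow>
      Delta (v (l!0)) (v (l!1)) (v (l!2)) * Delta (v (l!3)) (v (l!4)) (v (l!5))
      < Delta (v (l!2)) (v (l!3)) (v (l!4)) * Delta (v (l!0)) (v (l!1)) (v (l!5))" for l
  \<comment> \<open>The truth values of \<alpha> < \<beta> and \<alpha> < \<gamma> become the low
    and the high binary digit. Lists that are too short still get a colour below 4.\<close>
  define colour where "colour l = of_bool (beta_cond l) + 2 * (of_bool (gamma_cond l) :: nat)" for l
  have "finite {1..m}" "N \<le> card {1..m}" "\<forall>U. colour (sorted_list_of_set U) < 4"
    using \<open>N \<le> m\<close> by (simp_all add: colour_def of_bool_def)
  from arrowsE[OF N(1) this] obtain H c where H: "H \<subseteq> {1..m}" "card H = n"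
    and hom: "\<And>U. U \<subseteq> H \<Longrightarrow> card U = 6 \<Longrightarrow> colour (sorted_list_of_set U) = c"
    by metis
  have "finite H" using H finite_subset by blast
  then obtain h where h: "bij_betw h {..<n} H" "strict_mono_on {..<n} h"
    using ex_bij_betw_strict_mono_card[of H] H(2) by metis
  \<comment> \<open>Shifts the enumeration of \<open>H\<close> to indices starting at 1.\<close>
  define i where "i j = h (j - 1)" for j
  have mono: "i a < i b" if "1 \<le> a" "a < b" "b \<le> n" for a b
    using strict_mono_onD[OF h(2), of "a - 1" "b - 1"] that by (auto simp: i_def)
  have iH: "i a \<in> H" if "1 \<le> a" "a \<le> n" for a
    using h(1) that by (auto simp: i_def bij_betw_def)
  define w where "w = v \<circ> i"
  have ordw: "positively_ordered n w"
    unfolding positively_ordered_def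
  proof (intro allI impI)
    fix a b c assume abc: "1 \<le> a \<and> a < b \<and> b < c \<and> c \<le> n"
    have "1 \<le> i a" "i c \<le> m" using iH[of a] iH[of c] H abc by auto
    then show "0 < Delta (w a) (w b) (w c)"
      using positively_orderedD[OF ordv, of "i a" "i b" "i c"] mono abc by (simp add: w_def)
  qed
  have colour: "colour [i a1, i a2, i a3, i a4, i a5, i a6] = c"
    if a: "1 \<le> a1" "a1 < a2" "a2 < a3" "a3 < a4" "a4 < a5" "a5 < a6" "a6 \<le> n" for a1 a2 a3 a4 a5 a6
  proof -
    let ?l = "[i a1, i a2, i a3, i a4, i a5, i a6]"
    have "i a1 < i a2" "i a2 < i a3" "i a3 < i a4" "i a4 < i a5" "i a5 < i a6"
      using a by (auto intro!: mono)
    then have l: "sorted ?l" "distinct ?l" by auto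
    have "set ?l \<subseteq> H" using a by (auto intro!: iH)
    moreover have "card (set ?l) = 6" using distinct_card[OF l(2)] by simp
    ultimately have "colour (sorted_list_of_set (set ?l)) = c" by (rule hom)
    then show ?thesis using l sorted_list_of_set.idem_if_sorted_distinct by metis
  qed
  have ord8: "positively_ordered 8 w" using ordw assms(1) by (auto simp: positively_ordered_def)
  \<comment> \<open>An even \<open>c\<close> would mean \<alpha> \<ge> \<beta> on all sextuples,
    which already fails on the first eight points.\<close>
  have "odd c"
  proof (rule ccontr)
    assume "\<not> odd c"
    have "\<not> beta_cond [i a1, i a2, i a3, i a4, i a5, i a6]"
      if "1 \<le> a1" "a1 < a2" "a2 < a3" "a3 < a4" "a4 < a5" "a5 < a6" "a6 \<le> n" for a1 a2 a3 a4 a5 a6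
      using colour[OF that] \<open>\<not> odd c\<close> by (auto simp: colour_def)
    then show False
      using assms(1) by (intro not_all_alpha_ge_beta[OF ord8]) (simp add: beta_cond_def w_def not_less)
  qed
  have "c \<ge> 2"
  proof (rule ccontr)
    assume "\<not> c \<ge> 2"
    have "\<not> gamma_cond [i a1, i a2, i a3, i a4, i a5, i a6]"
      if "1 \<le> a1" "a1 < a2" "a2 < a3" "a3 < a4" "a4 < a5" "a5 < a6" "a6 \<le> n" for a1 a2 a3 a4 a5 a6
      using colour[OF that] \<open>\<not> c \<ge> 2\<close> by (auto simp: colour_def)
    then show False
      using assms(1) by (intro not_all_alpha_ge_gamma[OF ord8]) (simp add: gamma_cond_def w_def not_less)
  qed
  \<comment> \<open>Colours are at most 3, so an odd one that is at least 2 has both digits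
    set.\<close>
  have conds: "beta_cond [i a1, i a2, i a3, i a4, i a5, i a6]" "gamma_cond [i a1, i a2, i a3, i a4, i a5, i a6]"
    if "1 \<le> a1" "a1 < a2" "a2 < a3" "a3 < a4" "a4 < a5" "a5 < a6" "a6 \<le> n" for a1 a2 a3 a4 a5 a6
    using colour[OF that] \<open>odd c\<close> \<open>c \<ge> 2\<close> by (auto simp: colour_def of_bool_def split: if_splits)
  have "admissible n w"
    using assms(1) conds
    by (intro admissible_if_alpha_minimal ordw) (simp_all add: beta_cond_def gamma_cond_def w_def)
  moreover have "strict_mono_on {1..n} i" using mono by (auto simp: strict_mono_on_def)
  moreover have "i ` {1..n} \<subseteq> {1..m}" using iH H by auto
  ultimately show ?thesis unfolding w_def by blast
qed

end
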